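(* Let $\pi=x_1^2x_2^2x_3^2$ (with distinct variables $x_1,x_2,x_3$). For every $m\ge4$, $\mathrm{TD}(\pi,\Pi^2_{\infty,m,cf})=\infty$.
   Context: Fix a countably infinite set $X$ of variables and an alphabet $\Sigma$ with $|\Sigma|=2$, disjoint from $X$. A pattern is a nonempty finite string over $X\cup\Sigma$; it is constant-free if it contains no letter. A substitution is a morphism $(X\cup\Sigma)^*\to\Sigma^*$ fixing letters; $L(\pi)$ (erasing pattern language) is the set of all images of $\pi$. $\Pi^2_{\infty,m,cf}$ is the class of constant-free patterns over a binary alphabet in which every variable occurs at most $m$ times. A labelled example is $(w,\pm)$ with $w\in\Sigma^*$; a teaching set for $\pi$ w.r.t. a class $\Pi$ is a set $T$ of labelled examples consistent with $\pi$ ($w\in L(\pi)$ iff label $+$) such that every $\tau\in\Pi$ consistent with $T$ has $L(\tau)=L(\pi)$; $\mathrm{TD}(\pi,\Pi)$ is the minimum size of such a set, $\infty$ if no finite teaching set exists. *)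

theory Defs
  imports Main "HOL-Library.Extended_Nat"
begin

(* Variables X = nat (countably infinite), binary alphabet Sigma = bool.
   A symbol is Inl x (variable) or Inr a (letter). *)
type_synonym pattern = "(nat + bool) list"

fun subst_sym :: "(nat \<Rightarrow> bool list) \<Rightarrow> nat + bool \<Rightarrow> bool list" where
  "subst_sym h (Inl x) = h x"
| "subst_sym h (Inr a) = [a]"

definition apply_subst :: "(nat \<Rightarrow> bool list) \<Rightarrow> pattern \<Rightarrow> bool list" where
  "apply_subst h p = concat (map (subst_sym h) p)"

definition lang :: "pattern \<Rightarrow> bool list set" where
  "lang p = {apply_subst h p | h. True}"

definition const_free :: "pattern \<Rightarrow> bool" where
  "const_free p \<longleftrightarrow> (\<forall>s\<in>set p. \<exists>x. s = Inl x)"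

definition cf_class :: "nat \<Rightarrow> pattern set" where
  "cf_class m = {p. p \<noteq> [] \<and> const_free p \<and> (\<forall>x. count_list p (Inl x) \<le> m)}"

definition consistent :: "pattern \<Rightarrow> (bool list \<times> bool) set \<Rightarrow> bool" where
  "consistent p T \<longleftrightarrow> (\<forall>(w, b)\<in>T. (w \<in> lang p) = b)"

definition teaching_set :: "pattern \<Rightarrow> pattern set \<Rightarrow> (bool list \<times> bool) set \<Rightarrow> bool" where
  "teaching_set p C T \<longleftrightarrow> consistent p T \<and> (\<forall>\<tau>\<in>C. consistent \<tau> T \<longrightarrow> lang \<tau> = lang p)"

definition TD :: "pattern \<Rightarrow> pattern set \<Rightarrow> enat" where
  "TD p C = (if \<exists>T. finite T \<and> teaching_set p C T
             then enat (LEAST n. \<exists>T. finite T \<and> teaching_set p C T \<and> card T = n)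
             else \<infinity>)"

end

theory Submission
  imports Defs
begin

text \<open>
  The language of \<open>x\<^sub>1\<^sup>2x\<^sub>2\<^sup>2x\<^sub>3\<^sup>2\<close> has no telltale (Reidenbach): every finite subset \<open>F\<close> of it lies in the
  language of some \<open>Y\<^sub>1\<^sup>2Y\<^sub>2\<^sup>2Y\<^sub>3\<^sup>2\<close> in which each variable occurs at most twice in \<open>Y\<^sub>1Y\<^sub>2Y\<^sub>3\<close>, and each
  variable of \<open>Y\<^sub>1\<close> exactly twice. For one word \<open>u\<^sup>2v\<^sup>2w\<^sup>2\<close> this is achieved by replacing equal letters of
  \<open>uvw\<close> by variables in pairs from left to right; only the last occurrence of a letter can stay
  unpaired. If that occurrence is in \<open>u\<close>, then \<open>v\<close> and \<open>w\<close> are powers of the other letter, so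
  \<open>u\<^sup>2v\<^sup>2w\<^sup>2 = u\<^sup>2(vw)\<^sup>2\<close> is already an image of \<open>x\<^sup>2y\<^sup>2\<close>. Finitely many such triples are joined componentwise.

  The inclusion in the language of \<open>x\<^sub>1\<^sup>2x\<^sub>2\<^sup>2x\<^sub>3\<^sup>2\<close> is strict: with \<open>b\<close> for \<open>True\<close> and \<open>a\<close> for \<open>False\<close>, let \<open>W = (bab)(ba\<^sup>2b)\<dots>(ba\<^sup>Mb)\<close> with \<open>M > |Y\<^sub>1|\<close>.
  In any factorisation of \<open>W\<^sup>2b\<^sup>2a\<^sup>2\<close> into three squares the first square is \<open>W\<^sup>2\<close>, so some variable
  of \<open>Y\<^sub>1\<close> would be mapped to a word containing a block \<open>ba\<^sup>ib\<close>; but this block occurs only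
  once in \<open>W\<close> and not in the two remaining roots.
\<close>

section \<open>Products of three squares and their languages\<close>

definition triple_pattern :: "nat list \<Rightarrow> nat list \<Rightarrow> nat list \<Rightarrow> pattern" where
  "triple_pattern X Y Z = map Inl (X @ X @ Y @ Y @ Z @ Z)"

text \<open>The bound 2 becomes 4 occurrences once the roots are squared. The last clause is what
  later makes the inclusion of languages strict.\<close>

definition paired_triple :: "nat list \<Rightarrow> nat list \<Rightarrow> nat list \<Rightarrow> bool" where
  "paired_triple X Y Z \<longleftrightarrow> X @ Y @ Z \<noteq> [] \<and> (\<forall>x. count_list (X @ Y @ Z) x \<le> 2) \<and>
     (\<forall>x\<in>set X. count_list (X @ Y @ Z) x = 2)"

lemma apply_subst_map_Inl: "apply_subst h (map Inl X) = concat (map h X)"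
  by (simp add: apply_subst_def comp_def)

lemma lang_triple_pattern:
  "s \<in> lang (triple_pattern X Y Z) \<longleftrightarrow>
    (\<exists>h. let p = concat (map h X); q = concat (map h Y); r = concat (map h Z)
      in s = p @ p @ q @ q @ r @ r)"
  unfolding lang_def triple_pattern_def apply_subst_map_Inl Let_def by simp

lemma lang_three_squares:
  assumes "distinct [x1, x2, x3]"
  shows "s \<in> lang (triple_pattern [x1] [x2] [x3]) \<longleftrightarrow> (\<exists>u v w. s = u @ u @ v @ v @ w @ w)"
proof
  assume "\<exists>u v w. s = u @ u @ v @ v @ w @ w"
  then obtain u v w where "s = u @ u @ v @ v @ w @ w" by blast
  then show "s \<in> lang (triple_pattern [x1] [x2] [x3])"
    unfolding lang_triple_pattern Let_def using assms
    by (intro exI[of _ "\<lambda>x. if x = x1 then u else if x = x2 then v else w"]) auto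
qed (auto simp: lang_triple_pattern Let_def)

section \<open>Covering finitely many words\<close>

lemma count_list_interleave:
  fixes xs ys :: "nat list"
  shows "count_list (map ((*) 2) xs) n = (if even n then count_list xs (n div 2) else 0)"
    and "count_list (map (\<lambda>x. Suc (2 * x)) ys) n = (if odd n then count_list ys (n div 2) else 0)"
proof -
  have even: "2 * x = n \<longleftrightarrow> even n \<and> x = n div 2"
    and odd: "Suc (2 * x) = n \<longleftrightarrow> odd n \<and> x = n div 2" for x
    by presburger+
  show "count_list (map ((*) 2) xs) n = (if even n then count_list xs (n div 2) else 0)"
    by (induction xs) (simp_all add: even)
  show "count_list (map (\<lambda>x. Suc (2 * x)) ys) n = (if odd n then count_list ys (n div 2) else 0)"
    by (induction ys) (simp_all add: odd)
qed

text \<open>Renaming by \<open>f\<close> and \<open>g\<close> makes the two variable sets disjoint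
  (even and odd) and keeps all counts. Erasing the variables of one parity recovers either
  language.\<close>

lemma paired_triple_join:
  assumes "paired_triple X Y Z" and "paired_triple X' Y' Z'"
  shows "\<exists>U V W. paired_triple U V W \<and>
    lang (triple_pattern X Y Z) \<union> lang (triple_pattern X' Y' Z') \<subseteq> lang (triple_pattern U V W)"
proof -
  define f :: "nat \<Rightarrow> nat" where "f = (*) 2"
  define g :: "nat \<Rightarrow> nat" where "g = (\<lambda>x. Suc (2 * x))"
  define j where "j A B = map f A @ map g B" for A B
  have cnt: "count_list (j A B) n
      = (if even n then count_list A (n div 2) else count_list B (n div 2))" for A B n
    by (simp add: j_def f_def g_def count_list_interleave)
  have mem: "n \<in> set (j A B) \<longleftrightarrow> n div 2 \<in> (if even n then set A else set B)" for A B n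
    by (metis cnt count_list_0_iff)
  have "paired_triple (j X X') (j Y Y') (j Z Z')"
    using assms unfolding paired_triple_def
    by (auto simp: cnt mem split: if_splits) (auto simp: j_def)
  moreover have "s \<in> lang (triple_pattern (j X X') (j Y Y') (j Z Z'))"
    if s: "s \<in> lang (triple_pattern X Y Z)" for s
  proof -
    obtain h where h: "let p = concat (map h X); q = concat (map h Y); r = concat (map h Z)
      in s = p @ p @ q @ q @ r @ r"
      using s unfolding lang_triple_pattern by blast
    define k where "k n = (if even n then h (n div 2) else [])" for n
    have "concat (map k (j A B)) = concat (map h A)" for A B
      by (simp add: j_def k_def f_def g_def comp_def)
    then show ?thesis
      using h unfolding lang_triple_pattern by (intro exI[of _ k]) simp
  qed
  moreover have "s \<in> lang (triple_pattern (j X X') (j Y Y') (j Z Z'))"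
    if s: "s \<in> lang (triple_pattern X' Y' Z')" for s
  proof -
    obtain h where h: "let p = concat (map h X'); q = concat (map h Y'); r = concat (map h Z')
      in s = p @ p @ q @ q @ r @ r"
      using s unfolding lang_triple_pattern by blast
    define k where "k n = (if even n then [] else h (n div 2))" for n
    have "concat (map k (j A B)) = concat (map h B)" for A B
      by (simp add: j_def k_def f_def g_def comp_def)
    then show ?thesis
      using h unfolding lang_triple_pattern by (intro exI[of _ k]) simp
  qed
  ultimately show ?thesis by blast
qed

section \<open>Pairing equal letters of a word\<close>

text \<open>The parity of a label records the letter, the rest of it the number of its pair.\<close>

definition pair_labels :: "bool list \<Rightarrow> nat list" where
  "pair_labels s =
    map (\<lambda>i. 2 * (count_list (take i s) (s ! i) div 2) + of_bool (s ! i)) [0..<length s]"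

lemma pair_labels_Nil [simp]: "pair_labels [] = []"
  by (simp add: pair_labels_def)

lemma length_pair_labels [simp]: "length (pair_labels s) = length s"
  by (simp add: pair_labels_def)

lemma pair_labels_snoc:
  "pair_labels (s @ [c]) = pair_labels s @ [2 * (count_list s c div 2) + of_bool c]"
  by (auto simp: pair_labels_def nth_append)

lemma pair_labels_append: "\<exists>ys. pair_labels (s @ t) = pair_labels s @ ys"
proof (induction t rule: rev_induct)
  case (snoc c t)
  then show ?case using pair_labels_snoc[of "s @ t" c] by auto
qed simp

lemma map_odd_pair_labels: "map odd (pair_labels s) = s"
  by (induction s rule: rev_induct) (auto simp: pair_labels_snoc)

text \<open>Counting from zero, occurrences \<open>2 * k\<close> and \<open>2 * k + 1\<close> of the
  letter \<open>odd n\<close> carry the label \<open>n\<close>, where \<open>k = n div 2\<close>.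
  Truncated subtraction gives 0 before this pair starts.\<close>

lemma count_list_pair_labels:
  "count_list (pair_labels s) n = min 2 (count_list s (odd n) - 2 * (n div 2))"
proof (induction s rule: rev_induct)
  case (snoc c s)
  have label: "2 * k + of_bool c = n \<longleftrightarrow> odd n = c \<and> k = n div 2" for k
    by (cases c) (simp_all, presburger+)
  have "count_list (pair_labels (s @ [c])) n = min 2 (count_list s (odd n) - 2 * (n div 2))
      + (if odd n = c \<and> count_list s c div 2 = n div 2 then 1 else 0)"
    using snoc label by (simp add: pair_labels_snoc)
  also have "\<dots> = min 2 (count_list (s @ [c]) (odd n) - 2 * (n div 2))"
  proof (cases "odd n = c")
    case True
    have "min 2 (a - 2 * k) + (if a div 2 = k then 1 else 0) = min 2 (Suc a - 2 * k)" for a k :: nat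
      by (cases "a div 2 = k") (auto simp: min_def)
    then show ?thesis using True by simp
  qed simp
  finally show ?case .
qed simp

text \<open>Every letter of \<open>u\<close> recurs in \<open>v @ w\<close>, so a pair begun in
  \<open>u\<close> is always completed.\<close>

lemma paired_triple_word:
  assumes "set u \<subseteq> set (v @ w)" and "v @ w \<noteq> []"
  shows "\<exists>X Y Z. paired_triple X Y Z \<and> u @ u @ v @ v @ w @ w \<in> lang (triple_pattern X Y Z)"
proof -
  obtain R where R: "pair_labels (u @ v @ w) = pair_labels u @ R"
    using pair_labels_append by blast
  define X where "X = pair_labels u"
  define Y where "Y = take (length v) R"
  define Z where "Z = drop (length v) R"
  have XYZ: "pair_labels (u @ v @ w) = X @ Y @ Z"
    by (simp add: R X_def Y_def Z_def)
  have "length R = length (v @ w)"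
    using arg_cong[OF R, of length] by simp
  then have len: "length X = length u" "length Y = length v"
    by (simp_all add: X_def Y_def)
  have "map odd X @ map odd Y @ map odd Z = u @ v @ w"
    using map_odd_pair_labels[of "u @ v @ w"] XYZ by simp
  then have odd: "map odd X = u" "map odd Y = v" "map odd Z = w"
    using len by (auto simp: append_eq_append_conv)
  have "count_list (X @ Y @ Z) x = 2" if "x \<in> set X" for x
  proof -
    have "count_list (pair_labels u) x \<noteq> 0"
      using that by (simp add: X_def count_list_0_iff)
    then have less: "2 * (x div 2) < count_list u (odd x)"
      unfolding count_list_pair_labels by auto
    then have "odd x \<in> set u"
      using count_notin by fastforce
    then have "count_list (v @ w) (odd x) > 0"
      using assms(1) by (auto simp: count_list_0_iff simp flip: neq0_conv)
    then have "count_list (u @ v @ w) (odd x) - 2 * (x div 2) \<ge> 2"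
      using less unfolding count_list_append by linarith
    then show ?thesis
      unfolding XYZ[symmetric] count_list_pair_labels by simp
  qed
  moreover have "count_list (X @ Y @ Z) x \<le> 2" for x
    unfolding XYZ[symmetric] count_list_pair_labels by simp
  moreover have "X @ Y @ Z \<noteq> []"
    using assms(2) odd by auto
  ultimately have "paired_triple X Y Z"
    unfolding paired_triple_def by blast
  \<comment> \<open>The witness substitution sends each label to the letter stored in its
    parity.\<close>
  moreover have "concat (map (\<lambda>n. [odd n]) A) = map odd A" for A :: "nat list"
    by (induction A) auto
  then have "u @ u @ v @ v @ w @ w \<in> lang (triple_pattern X Y Z)"
    unfolding lang_triple_pattern using odd
    by (intro exI[of _ "\<lambda>n. [odd n]"]) simp
  ultimately show ?thesis by blast
qed

lemma paired_triple_two_squares: "paired_triple [] [0] [Suc 0]"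
  by (simp add: paired_triple_def)

lemma two_squares_in_lang: "u @ u @ v @ v \<in> lang (triple_pattern [] [0] [Suc 0])"
  unfolding lang_triple_pattern
  by (intro exI[of _ "\<lambda>n. if n = 0 then u else v"]) simp

lemma paired_triple_three_squares:
  "\<exists>X Y Z. paired_triple X Y Z \<and> u @ u @ v @ v @ w @ w \<in> lang (triple_pattern X Y Z)"
proof (cases "set u \<subseteq> set (v @ w) \<and> v @ w \<noteq> []")
  case True
  then show ?thesis using paired_triple_word by blast
next
  case False
  \<comment> \<open>Either some letter of \<open>u\<close> is missing from \<open>v @ w\<close>, or
    \<open>v @ w\<close> is empty and any letter will do.\<close>
  then obtain c where "c \<notin> set (v @ w)"
    by (metis empty_iff list.set(1) subsetI)
  then have "x = (\<not> c)" if "x \<in> set (v @ w)" for x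
    using that by (cases x; cases c) auto
  then have "v = replicate (length v) (\<not> c)" "w = replicate (length w) (\<not> c)"
    by (simp_all add: replicate_eqI)
  then have "v @ w = w @ v"
    by (metis add.commute replicate_add)
  then have "u @ u @ v @ v @ w @ w = u @ u @ (v @ w) @ (v @ w)"
    by (metis append.assoc)
  then show ?thesis
    using two_squares_in_lang paired_triple_two_squares by metis
qed

lemma paired_triple_finite_cover:
  assumes "finite F" and "\<And>s. s \<in> F \<Longrightarrow> \<exists>u v w. s = u @ u @ v @ v @ w @ w"
  shows "\<exists>X Y Z. paired_triple X Y Z \<and> F \<subseteq> lang (triple_pattern X Y Z)"
  using assms
proof (induction F rule: finite_induct)
  case empty
  then show ?case using paired_triple_two_squares by blast
next
  case (insert s F)
  obtain X Y Z where 1: "paired_triple X Y Z" "F \<subseteq> lang (triple_pattern X Y Z)"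
    using insert by blast
  obtain X' Y' Z' where 2: "paired_triple X' Y' Z'" "s \<in> lang (triple_pattern X' Y' Z')"
    using insert.prems[of s] paired_triple_three_squares by blast
  show ?case
    using paired_triple_join[OF 1(1) 2(1)] 1(2) 2(2) by blast
qed

section \<open>Words separating the languages\<close>

definition block :: "nat \<Rightarrow> bool list" where
  "block i = True # replicate i False @ [True]"

abbreviation blocks :: "nat list \<Rightarrow> bool list" where
  "blocks ns \<equiv> concat (map block ns)"

lemma replicate_append_Cons_eq:
  assumes "a \<noteq> b" and "replicate m a @ b # s = replicate n a @ b # t"
  shows "m = n \<and> s = t"
  using assms
proof (induction m arbitrary: n)
  case 0
  then show ?case by (cases n) auto
next
  case (Suc m)
  then show ?case by (cases n) auto
qed

lemma replicate_append_Cons_split: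
  assumes "a \<noteq> b" and "replicate m a @ b # t = s @ b # t'"
  shows "(s = replicate m a \<and> t = t') \<or> (\<exists>s'. s = replicate m a @ b # s' \<and> t = s' @ b # t')"
  using assms
proof (induction m arbitrary: s)
  case 0
  then show ?case by (cases s) auto
next
  case (Suc m)
  then show ?case by (cases s) auto
qed

text \<open>Adjacent blocks meet in two letters \<open>True\<close>, so a block with
  \<open>i > 0\<close> cannot start at the closing letter of another. The tail \<open>e\<close>
  allows for the end of \<open>ladder_word\<close>.\<close>

lemma block_occurrence_in_blocks:
  assumes "blocks ns @ e = s @ block i @ t" and "i > 0"
    and "\<And>s t. e \<noteq> s @ block i @ t" and "e = [] \<or> hd e"
  shows "\<exists>ns1 ns2. ns = ns1 @ i # ns2 \<and> s = blocks ns1"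
  using assms(1)
proof (induction ns arbitrary: s)
  case Nil
  then show ?case using assms(3) by simp
next
  case (Cons n ns)
  show ?case
  proof (cases s)
    case Nil
    have "replicate n False @ True # (blocks ns @ e) = replicate i False @ True # t"
      using Cons.prems Nil by (simp add: block_def[of n] block_def[of i])
    then have "n = i"
      using replicate_append_Cons_eq[OF False_not_True] by blast
    then show ?thesis using Nil by (intro exI[of _ "[]"] exI[of _ ns]) simp
  next
    case s: (Cons c s')
    have eq: "replicate n False @ True # (blocks ns @ e)
        = s' @ True # (replicate i False @ True # t)" and c: c
      using Cons.prems s by (auto simp: block_def[of n] block_def[of i])
    consider "s' = replicate n False" "blocks ns @ e = replicate i False @ True # t"
      | s'' where "s' = replicate n False @ True # s''" "blocks ns @ e = s'' @ block i @ t"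
      using replicate_append_Cons_split[OF False_not_True eq] by (auto simp: block_def[of i])
    then show ?thesis
    proof cases
      case 1
      moreover have "blocks ns @ e = [] \<or> hd (blocks ns @ e)"
        using assms(4) by (cases ns) (auto simp: block_def)
      ultimately show ?thesis
        using assms(2) by (cases i) auto
    next
      case 2
      from Cons.IH[OF 2(2)] obtain ns1 ns2 where "ns = ns1 @ i # ns2" "s'' = blocks ns1"
        by blast
      then show ?thesis
        using s c 2(1) by (intro exI[of _ "n # ns1"] exI[of _ ns2]) (simp add: block_def[of n])
    qed
  qed
qed

lemma block_occurrence_unique:
  assumes "distinct ns" and "i > 0"
    and "blocks ns = s @ block i @ t" and "blocks ns = s' @ block i @ t'"
  shows "s = s'"
proof -
  have ex: "\<exists>ns1 ns2. ns = ns1 @ i # ns2 \<and> s = blocks ns1"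
    if "blocks ns = s @ block i @ t" for s t
    using block_occurrence_in_blocks[of ns "[]" s i t] assms(2) that by (simp add: block_def)
  obtain ns1 ns2 where 1: "ns = ns1 @ i # ns2" "s = blocks ns1"
    using ex[OF assms(3)] by blast
  obtain ns1' ns2' where 2: "ns = ns1' @ i # ns2'" "s' = blocks ns1'"
    using ex[OF assms(4)] by blast
  have "i \<notin> set ns1" "i \<notin> set ns2"
    using assms(1) by (simp_all add: 1(1))
  then have "ns1 = ns1'"
    using 1(1) 2(1) by (metis append_Cons_eq_iff)
  then show ?thesis using 1 2 by simp
qed

text \<open>Pigeonhole: each cut between factors destroys at most one block. The prefix
  \<open>s\<close> absorbs the remains of a cut block in the induction.\<close>

lemma block_in_factor:
  assumes "concat ws = s @ blocks ns" and "length ws < length ns"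
  shows "\<exists>w\<in>set ws. \<exists>i\<in>set ns. \<exists>s t. w = s @ block i @ t"
  using assms
proof (induction ws arbitrary: s ns)
  case Nil
  then show ?case by (cases ns) (auto simp: block_def)
next
  case (Cons w ws)
  then obtain n ns' where ns: "ns = n # ns'" by (cases ns) auto
  have "w @ concat ws = (s @ block n) @ blocks ns'"
    using Cons.prems ns by simp
  then consider us where "w = (s @ block n) @ us"
    | us where "concat ws = us @ blocks ns'"
    unfolding append_eq_append_conv2 by auto
  then show ?case
  proof cases
    case 1
    then show ?thesis using ns by auto
  next
    case 2
    then have "\<exists>w\<in>set ws. \<exists>i\<in>set ns'. \<exists>s t. w = s @ block i @ t"
      using Cons.IH Cons.prems(2) ns by simp
    then show ?thesis
      using ns by (meson list.set_intros(2))
  qed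
qed

section \<open>Square factorisations of the ladder word\<close>

definition ladder :: "nat \<Rightarrow> bool list" where
  "ladder M = blocks [1..<Suc M]"

definition ladder_word :: "nat \<Rightarrow> bool list" where
  "ladder_word M = ladder M @ ladder M @ [True, True, False, False]"

lemma ladder_Suc: "ladder (Suc M) = block 1 @ blocks [2..<Suc (Suc M)]"
  unfolding ladder_def by (simp add: upt_conv_Cons[of "Suc 0"] numeral_2_eq_2 del: upt_Suc)

text \<open>Once \<open>p\<close> is known to begin with \<open>block 1\<close>, its second copy
  marks another occurrence of that block, and the only one available starts the second
  ladder.\<close>

lemma ladder_word_prefix_square:
  assumes "ladder_word M = p @ p @ t" and "p \<noteq> []" and "M > 0"
  shows "p = ladder M"
proof -
  obtain M' where M: "M = Suc M'" using assms(3) gr0_conv_Suc by blast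
  let ?e = "[True, True, False, False]"
  have "\<exists>z. ladder_word M = block 1 @ True # False # z"
  proof (cases M')
    case 0
    then show ?thesis by (simp add: M ladder_word_def ladder_def block_def)
  next
    case (Suc k)
    have "[2..<Suc (Suc M')] = 2 # [3..<Suc (Suc M')]"
      using Suc by (subst upt_conv_Cons) (auto simp: numeral_3_eq_3 numeral_2_eq_2)
    then show ?thesis
      by (simp add: M ladder_word_def ladder_Suc block_def numeral_2_eq_2 del: upt_Suc)
  qed
  then obtain z where z: "p @ p @ t = [True, False, True, True, False] @ z"
    using assms(1) by (auto simp: block_def)
  \<comment> \<open>The initial letters \<open>babba\<close> exclude the squares of roots of length
    1 and 2.\<close>
  have "length p \<noteq> 1" "length p \<noteq> 2"
    using z by (auto simp: length_Suc_conv numeral_2_eq_2)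
  moreover have "length p \<noteq> 0" using assms(2) by simp
  ultimately have "length p \<ge> 3" by linarith
  then have "take 3 p = block 1"
    using arg_cong[OF z, of "take 3"] by (simp add: block_def)
  then obtain p' where p': "p = block 1 @ p'"
    by (metis append_take_drop_id)
  have "blocks ([1..<Suc M] @ [1..<Suc M]) @ ?e = p @ block 1 @ (p' @ t)"
    using assms(1) p' by (simp add: ladder_word_def ladder_def del: upt_Suc)
  moreover have "?e \<noteq> s @ block 1 @ t" for s t
    by (auto simp: block_def Cons_eq_append_conv)
  ultimately obtain ns1 ns2 where
    ns: "[1..<Suc M] @ [1..<Suc M] = ns1 @ 1 # ns2" and p: "p = blocks ns1"
    using block_occurrence_in_blocks[of "[1..<Suc M] @ [1..<Suc M]" ?e p 1 "p' @ t"]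
    by fastforce
  obtain n ns1' where ns1: "ns1 = n # ns1'"
    using p assms(2) by (cases ns1) auto
  have split: "[1..<Suc M] = 1 # [2..<Suc M]"
    using assms(3) by (subst upt_conv_Cons) (auto simp: numeral_2_eq_2)
  have "[2..<Suc M] @ 1 # [2..<Suc M] = ns1' @ 1 # ns2" and n: "n = 1"
    using ns unfolding split ns1 by auto
  moreover have "1 \<notin> set [2..<Suc M]" by auto
  moreover have "count_list ([2..<Suc M] @ 1 # [2..<Suc M]) 1 = 1"
    by (simp add: count_list_0_iff del: upt_Suc)
  then have "1 \<notin> set ns1'"
    unfolding calculation(1) by (auto simp: count_list_0_iff[symmetric])
  ultimately have "[2..<Suc M] = ns1'"
    by (metis append_Cons_eq_iff count_list_0_iff)
  then show ?thesis
    using p ns1 n split by (simp add: ladder_def del: upt_Suc)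
qed

lemma ladder_word_three_squares:
  assumes "ladder_word M = p @ p @ q @ q @ r @ r" and "M > 0"
  shows "p = ladder M \<and> length q \<le> 2 \<and> length r \<le> 2"
proof -
  let ?e = "[True, True, False, False]"
  \<comment> \<open>This and \<open>nonsq'\<close> exclude an empty first root: the whole word would
    be a square, or the tail left after two ladders would be.\<close>
  have nonsq: "x @ x \<noteq> ?e" for x :: "bool list"
  proof
    assume x: "x @ x = ?e"
    have "x = take 2 (x @ x)"
      using arg_cong[OF x, of length] by simp
    then show False using x by simp
  qed
  have nonsq': "ladder_word M \<noteq> x @ x" for x
  proof
    assume x: "ladder_word M = x @ x"
    then have "x \<noteq> []" and "ladder_word M = x @ x @ []"
      unfolding ladder_word_def by force+
    then have "x = ladder M"
      using ladder_word_prefix_square assms(2) by blast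
    then show False using x by (simp add: ladder_word_def)
  qed
  have "p \<noteq> []"
  proof
    assume "p = []"
    then have qr: "ladder_word M = q @ q @ r @ r" using assms(1) by simp
    then have "q \<noteq> []" using nonsq'[of r] by auto
    then have "q = ladder M" using ladder_word_prefix_square qr assms(2) by blast
    then show False using qr nonsq[of r] by (simp add: ladder_word_def)
  qed
  then have p: "p = ladder M"
    using ladder_word_prefix_square assms by blast
  then have "q @ q @ r @ r = ?e"
    using assms(1) by (simp add: ladder_word_def)
  from arg_cong[OF this, of length] show ?thesis using p by simp
qed

lemma ladder_word_notin_lang:
  assumes "paired_triple X Y Z"
  shows "ladder_word (Suc (length X)) \<notin> lang (triple_pattern X Y Z)"
proof
  \<comment> \<open>One block more than \<open>X\<close> has entries, so some image of a variable
    contains a whole block.\<close>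
  let ?M = "Suc (length X)"
  assume "ladder_word ?M \<in> lang (triple_pattern X Y Z)"
  then obtain h where "ladder_word ?M = concat (map h X) @ concat (map h X) @
      concat (map h Y) @ concat (map h Y) @ concat (map h Z) @ concat (map h Z)"
    unfolding lang_triple_pattern Let_def by blast
  then have X: "concat (map h X) = ladder ?M"
    and YZ: "length (concat (map h Y)) \<le> 2" "length (concat (map h Z)) \<le> 2"
    using ladder_word_three_squares by blast+
  obtain x i s t where x: "x \<in> set X" and i: "i \<in> set [1..<Suc ?M]"
    and hx: "h x = s @ block i @ t"
    using block_in_factor[of "map h X" "[]" "[1..<Suc ?M]"] X
    by (auto simp: ladder_def simp del: upt_Suc)
  have "i > 0" using i by auto
  then have long: "length (h x) > 2" by (simp add: hx block_def)
  \<comment> \<open>The image of \<open>x\<close> is too long for the roots from \<open>Y\<close>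
    and \<open>Z\<close>, so both occurrences of \<open>x\<close> lie in \<open>X\<close>.\<close>
  have notin: "x \<notin> set A" if A: "length (concat (map h A)) \<le> 2" for A
  proof
    assume "x \<in> set A"
    then obtain A1 A2 where "A = A1 @ x # A2" by (meson split_list)
    then show False using A long by simp
  qed
  have "count_list (X @ Y @ Z) x = 2"
    using assms x by (simp add: paired_triple_def)
  then have two: "count_list X x = 2"
    using notin YZ by (simp add: count_list_0_iff)
  obtain A B where A: "X = A @ x # B" "x \<notin> set A"
    using x split_list_first by fastforce
  then have "count_list B x \<noteq> 0"
    using two by (auto simp: count_list_0_iff)
  then obtain C D where B: "B = C @ x # D"
    by (metis count_notin split_list)
  have "ladder ?M = (concat (map h A) @ s) @ block i @ (t @ concat (map h B))"
    "ladder ?M = (concat (map h A) @ h x @ concat (map h C) @ s) @ block i @ (t @ concat (map h D))"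
    using X by (simp_all add: A B hx)
  then have "concat (map h A) @ s = concat (map h A) @ h x @ concat (map h C) @ s"
    using block_occurrence_unique[OF distinct_upt \<open>i > 0\<close>] unfolding ladder_def by blast
  from arg_cong[OF this, of length] show False using long by simp
qed

section \<open>The teaching dimension\<close>

lemma triple_pattern_in_cf_class:
  assumes "paired_triple X Y Z" and "m \<ge> 4"
  shows "triple_pattern X Y Z \<in> cf_class m"
proof -
  have "count_list (triple_pattern X Y Z) (Inl x) \<le> m" for x
  proof -
    have "count_list (triple_pattern X Y Z) (Inl x) = 2 * count_list (X @ Y @ Z) x"
      unfolding triple_pattern_def by (simp only: count_list_map_conv[OF inj_Inl] count_list_append mult_2 ac_simps)
    also have "\<dots> \<le> 2 * 2"
      using assms(1) unfolding paired_triple_def by (intro mult_left_mono) auto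
    finally show ?thesis using assms(2) by simp
  qed
  moreover have "triple_pattern X Y Z \<noteq> []"
    using assms(1) by (auto simp: triple_pattern_def paired_triple_def)
  ultimately show ?thesis
    by (auto simp: cf_class_def const_free_def triple_pattern_def)
qed

theorem mainTheorem18:
  fixes x1 x2 x3 m :: nat
  assumes "distinct [x1, x2, x3]" and "m \<ge> 4"
  shows "TD [Inl x1, Inl x1, Inl x2, Inl x2, Inl x3, Inl x3] (cf_class m) = \<infinity>"
proof -
  define P where "P = triple_pattern [x1] [x2] [x3]"
  have lang_P: "s \<in> lang P \<longleftrightarrow> (\<exists>u v w. s = u @ u @ v @ v @ w @ w)" for s
    unfolding P_def by (rule lang_three_squares[OF assms(1)])
  have "\<not> teaching_set P (cf_class m) T" if fin: "finite T" for T
  proof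
    assume T: "teaching_set P (cf_class m) T"
    \<comment> \<open>Only positive examples need covering: negative ones are respected by any
      pattern whose language lies in \<open>lang P\<close>.\<close>
    define F where "F = {s. (s, True) \<in> T}"
    have "F \<subseteq> fst ` T" by (force simp: F_def)
    then have "finite F" using fin finite_surj by blast
    moreover have "s \<in> lang P" if "s \<in> F" for s
      using T that by (auto simp: teaching_set_def consistent_def F_def)
    ultimately obtain X Y Z where XYZ: "paired_triple X Y Z"
      and F: "F \<subseteq> lang (triple_pattern X Y Z)"
      using paired_triple_finite_cover lang_P by metis
    have sub: "lang (triple_pattern X Y Z) \<subseteq> lang P"
      unfolding subset_iff lang_P lang_triple_pattern Let_def by blast
    have "consistent (triple_pattern X Y Z) T"
      unfolding consistent_def
    proof clarify
      fix s b assume sb: "(s, b) \<in> T"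
      show "(s \<in> lang (triple_pattern X Y Z)) = b"
      proof (cases b)
        case True
        then show ?thesis using sb F by (auto simp: F_def)
      next
        case False
        then have "s \<notin> lang P"
          using T sb by (auto simp: teaching_set_def consistent_def)
        then show ?thesis using sub False by blast
      qed
    qed
    then have "lang (triple_pattern X Y Z) = lang P"
      using T triple_pattern_in_cf_class[OF XYZ assms(2)] by (auto simp: teaching_set_def)
    moreover have "ladder_word (Suc (length X)) =
        ladder (Suc (length X)) @ ladder (Suc (length X)) @ [True] @ [True] @ [False] @ [False]"
      by (simp add: ladder_word_def)
    then have "ladder_word (Suc (length X)) \<in> lang P"
      unfolding lang_P by blast
    ultimately show False
      using ladder_word_notin_lang[OF XYZ] by simp
  qed
  then show ?thesis
    by (auto simp: TD_def P_def triple_pattern_def)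
qed

end
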